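(* For each positive integer $j$, the poset $P_j$ (defined in the context) is a polyunsaturated poset.
   Context: Definition of the posets $P_j$ (inductive). $P_1$ is a chain $Q_1$ of three elements $u<s_1<r_1$, and $T_1=\{u\}$. For $j>1$, $P_j$ is the disjoint union of $P_{j-1}$ with a new chain $Q_j$ of $j+1$ elements, plus one new relation: let $r_j$ be the maximal element of $Q_j$, $s_j$ the next-greatest element of $Q_j$, and $T_j$ the set of the remaining $j-1$ elements of $Q_j$; add the cover relation $s_{j-1}<s_j$ and extend by transitivity. All posets are finite. The height of a poset is the maximum size of a chain in it. For a positive integer $k$, $d_k(P)$ is the maximum size of a union of $k$ antichains in $P$. For a partition $\mathcal C$ of a finite set, $m_k(\mathcal C)=\sum_{C\in\mathcal C}\min\{k,|C|\}$. A chain partition of $P$ (a partition $\mathcal C$ of $P$ into chains) is $k$-saturated if $d_k(P)=m_k(\mathcal C)$. A poset $P$ of height $c$ is polyunsaturated if there are no distinct, nonconsecutive positive integers $k,l<c$ for which $P$ has a chain partition that is simultaneously $k$-saturated and $l$-saturated. *)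

theory Defs
  imports Main "HOL-Library.Disjoint_Sets"
begin

text \<open>
  A finite poset is given by a carrier \<open>A\<close> and a reflexive order relation \<open>r\<close>
  with \<open>partial_order_on A r\<close>; the pair \<open>(x, y) \<in> r\<close> means \<open>x \<le> y\<close>.
\<close>

definition chains_on :: "'a set \<Rightarrow> 'a rel \<Rightarrow> 'a set set" where
  "chains_on A r = {C \<in> Chains r. C \<subseteq> A}"

definition antichains_on :: "'a set \<Rightarrow> 'a rel \<Rightarrow> 'a set set" where
  "antichains_on A r = {C. C \<subseteq> A \<and> (\<forall>x\<in>C. \<forall>y\<in>C. (x, y) \<in> r \<longrightarrow> x = y)}"

definition height :: "'a set \<Rightarrow> 'a rel \<Rightarrow> nat" where
  "height A r = Max (card ` chains_on A r)"

text \<open>The antichains of a family may coincide or be empty, which does not affect the maximum.\<close>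

definition d_card :: "'a set \<Rightarrow> 'a rel \<Rightarrow> nat \<Rightarrow> nat" where
  "d_card A r k = Max {card (\<Union>i<k. F i) | F :: nat \<Rightarrow> 'a set. \<forall>i<k. F i \<in> antichains_on A r}"

definition m_card :: "'a set set \<Rightarrow> nat \<Rightarrow> nat" where
  "m_card \<C> k = (\<Sum>C\<in>\<C>. min k (card C))"

definition chain_partition :: "'a set \<Rightarrow> 'a rel \<Rightarrow> 'a set set \<Rightarrow> bool" where
  "chain_partition A r \<C> \<longleftrightarrow> partition_on A \<C> \<and> \<C> \<subseteq> chains_on A r"

definition saturated :: "'a set \<Rightarrow> 'a rel \<Rightarrow> nat \<Rightarrow> 'a set set \<Rightarrow> bool" where
  "saturated A r k \<C> \<longleftrightarrow> d_card A r k = m_card \<C> k"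

definition polyunsaturated :: "'a set \<Rightarrow> 'a rel \<Rightarrow> bool" where
  "polyunsaturated A r \<longleftrightarrow>
     finite A \<and> partial_order_on A r \<and>
     \<not> (\<exists>k l. 0 < k \<and> k < height A r \<and> 0 < l \<and> l < height A r \<and>
          k \<noteq> l \<and> k \<noteq> Suc l \<and> l \<noteq> Suc k \<and>
          (\<exists>\<C>. chain_partition A r \<C> \<and> saturated A r k \<C> \<and> saturated A r l \<C>))"

text \<open>
  The pair \<open>(i, p)\<close> is the element of \<open>Q\<^sub>i\<close> with exactly \<open>p\<close> elements of \<open>Q\<^sub>i\<close> below it,
  which makes the chains disjoint. Thus \<open>s\<^sub>i = s_elem i\<close> is the next-greatest element of \<open>Q\<^sub>i\<close>,
  the greatest one is \<open>r\<^sub>i = (i, Q_size i - 1)\<close>, and \<open>T\<^sub>i\<close> consists of the elements of \<open>Q\<^sub>i\<close> below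
  \<open>s\<^sub>i\<close>. The chain \<open>Q\<^sub>1\<close>, being \<open>u < s\<^sub>1 < r\<^sub>1\<close>, has three elements and is
  an exception to the size \<open>i + 1\<close>.
\<close>

definition Q_size :: "nat \<Rightarrow> nat" where
  "Q_size i = (if i = 1 then 3 else i + 1)"

definition Q_set :: "nat \<Rightarrow> (nat \<times> nat) set" where
  "Q_set i = {i} \<times> {..<Q_size i}"

definition Q_rel :: "nat \<Rightarrow> (nat \<times> nat) rel" where
  "Q_rel i = {((i, p), (i, q)) | p q. p \<le> q \<and> q < Q_size i}"

definition s_elem :: "nat \<Rightarrow> nat \<times> nat" where
  "s_elem i = (i, Q_size i - 2)"

text \<open>The value at \<open>0\<close> is a dummy: the posets are indexed by positive integers.\<close>

fun P_set :: "nat \<Rightarrow> (nat \<times> nat) set" where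
  "P_set 0 = {}"
| "P_set (Suc 0) = Q_set 1"
| "P_set (Suc (Suc j)) = P_set (Suc j) \<union> Q_set (Suc (Suc j))"

fun P_rel :: "nat \<Rightarrow> (nat \<times> nat) rel" where
  "P_rel 0 = {}"
| "P_rel (Suc 0) = Q_rel 1"
| "P_rel (Suc (Suc j)) =
     (P_rel (Suc j) \<union> Q_rel (Suc (Suc j)) \<union> {(s_elem (Suc j), s_elem (Suc (Suc j)))})\<^sup>+"

end

theory Submission
  imports Defs
begin

text \<open>
  Write \<open>u\<close> for the bottom of \<open>Q\<^sub>1\<close>. A largest union of \<open>k\<close> antichains is obtained from the
  elements other than \<open>u\<close> of the chains \<open>Q\<^sub>i\<close> with \<open>i < k\<close>, together with the top and the \<open>k - 1\<close>
  largest elements of \<open>T\<^sub>i\<close> for \<open>i \<ge> k\<close>; every chain \<open>X\<close> of a \<open>k\<close>-saturated partition meets it in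
  \<open>min k |X|\<close> elements. So if the partition is \<open>l\<close>-saturated, its chain through \<open>u\<close> contains
  \<open>s\<^sub>1, \<dots>, s\<^bsub>l-1\<^esub>\<close> and some \<open>r\<^sub>b\<close> with \<open>b \<ge> l - 1\<close>. If it is \<open>k\<close>-saturated, then for \<open>i > k\<close> the
  chain through the bottom of \<open>T\<^sub>i\<close> contains some \<open>r\<^sub>a\<close> with \<open>a \<ge> i\<close>. When \<open>l \<ge> k + 2\<close>, these are
  \<open>j - k + 1\<close> different chains, competing for the \<open>j - k\<close> elements \<open>r\<^bsub>k+1\<^esub>, \<dots>, r\<^sub>j\<close>.
\<close>

section \<open>Chains, antichains and saturation in an arbitrary finite poset\<close>

lemma chain_Int_antichain_card_le_1:
  assumes "X \<in> chains_on A r" "Y \<in> antichains_on A r"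
  shows "card (X \<inter> Y) \<le> 1"
proof (cases "finite (X \<inter> Y)")
  case True
  have "x = y" if "x \<in> X \<inter> Y" "y \<in> X \<inter> Y" for x y
    using assms that unfolding chains_on_def antichains_on_def Chains_def by blast
  then show ?thesis
    using True by (simp add: card_le_Suc0_iff_eq)
qed simp

lemma chain_Int_Union_antichains_card_le:
  fixes k :: nat
  assumes "X \<in> chains_on A r" "\<forall>i<k. F i \<in> antichains_on A r"
  shows "card (X \<inter> (\<Union>i<k. F i)) \<le> k"
proof -
  have "card (X \<inter> (\<Union>i<k. F i)) = card (\<Union>i<k. X \<inter> F i)"
    by (simp only: Int_UN_distrib)
  also have "\<dots> \<le> (\<Sum>i<k. card (X \<inter> F i))"
    by (rule card_UN_le) simp
  also have "\<dots> \<le> (\<Sum>i<k. 1)"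
    by (intro sum_mono chain_Int_antichain_card_le_1) (use assms in auto)
  finally show ?thesis by simp
qed

lemma d_card_eqI:
  assumes "finite A"
    and "\<forall>i<k. F i \<in> antichains_on A r"
    and "\<And>G. \<forall>i<k. G i \<in> antichains_on A r \<Longrightarrow> card (\<Union>i<k. G i) \<le> card (\<Union>i<k. F i)"
  shows "d_card A r k = card (\<Union>i<k. F i)"
  unfolding d_card_def
proof (rule Max_eqI)
  show "finite {card (\<Union>i<k. G i) |G. \<forall>i<k. G i \<in> antichains_on A r}"
    by (rule finite_subset[of _ "{..card (\<Union>i<k. F i)}"]) (use assms in auto)
qed (use assms in auto)

text \<open>Each block satisfies \<open>card (X \<inter> U) \<le> min k (card X)\<close>, where
  \<open>U\<close> is the union of the antichains. Saturation and the maximality of \<open>U\<close>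
  make the sums of both sides over the partition equal, which forces equality in every
  block.\<close>

lemma saturated_chain_Int_card:
  assumes "finite A" "chain_partition A r \<C>" "saturated A r k \<C>"
    and "\<forall>i<k. F i \<in> antichains_on A r" "card (\<Union>i<k. F i) = d_card A r k"
    and "X \<in> \<C>"
  shows "card (X \<inter> (\<Union>i<k. F i)) = min k (card X)"
proof -
  define U where "U = (\<Union>i<k. F i)"
  have part: "partition_on A \<C>" and chains: "\<C> \<subseteq> chains_on A r"
    using assms(2) by (auto simp: chain_partition_def)
  have "finite \<C>"
    using finite_elements[OF assms(1) part] .
  have fin: "finite Y" if "Y \<in> \<C>" for Y
    using that partition_onD1[OF part] finite_subset[OF _ assms(1), of Y] by blast
  have "U \<subseteq> A"
    using assms(4) by (auto simp: U_def antichains_on_def)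
  then have "U = (\<Union>Y\<in>\<C>. Y \<inter> U)"
    using partition_onD1[OF part] by blast
  moreover have "card (\<Union>Y\<in>\<C>. Y \<inter> U) = (\<Sum>Y\<in>\<C>. card (Y \<inter> U))"
  proof (rule card_UN_disjoint[OF \<open>finite \<C>\<close>])
    show "\<forall>Y\<in>\<C>. finite (Y \<inter> U)"
      using fin by blast
    show "\<forall>Y\<in>\<C>. \<forall>Z\<in>\<C>. Y \<noteq> Z \<longrightarrow> (Y \<inter> U) \<inter> (Z \<inter> U) = {}"
      using disjointD[OF partition_onD2[OF part]] by blast
  qed
  ultimately have "card U = (\<Sum>Y\<in>\<C>. card (Y \<inter> U))"
    by metis
  then have "(\<Sum>Y\<in>\<C>. card (Y \<inter> U)) = (\<Sum>Y\<in>\<C>. min k (card Y))"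
    using assms(3,5) by (simp add: U_def saturated_def m_card_def)
  moreover have "card (Y \<inter> U) \<le> min k (card Y)" if "Y \<in> \<C>" for Y
  proof (rule min.boundedI)
    show "card (Y \<inter> U) \<le> k"
      unfolding U_def using assms(4) chains that
      by (intro chain_Int_Union_antichains_card_le) auto
    show "card (Y \<inter> U) \<le> card Y"
      using fin[OF that] by (intro card_mono) auto
  qed
  ultimately have "card (X \<inter> U) = min k (card X)"
    by (rule sum_mono_inv) (use \<open>finite \<C>\<close> assms(6) in auto)
  then show ?thesis by (simp only: U_def)
qed

text \<open>A point of \<open>X\<close> outside the union makes the intersection smaller than
  \<open>X\<close>, so the minimum cannot be \<open>card X\<close>.\<close>

lemma saturated_chain_Int_card_eq:
  assumes "finite A" "chain_partition A r \<C>" "saturated A r k \<C>"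
    and "\<forall>i<k. F i \<in> antichains_on A r" "card (\<Union>i<k. F i) = d_card A r k"
    and "X \<in> \<C>" "x \<in> X" "x \<notin> (\<Union>i<k. F i)"
  shows "card (X \<inter> (\<Union>i<k. F i)) = k"
proof -
  have "X \<subseteq> A"
    using assms(2,6) by (auto simp: chain_partition_def partition_on_def)
  then have "card (X \<inter> (\<Union>i<k. F i)) < card X"
    using assms(1,7,8) by (intro psubset_card_mono) (auto intro: finite_subset)
  then show ?thesis
    using saturated_chain_Int_card[OF assms(1-6)] by simp
qed

section \<open>Explicit description of the carrier and the order of \<open>P\<^sub>j\<close>\<close>

lemma P_set_eq: "P_set j = (SIGMA i:{1..j}. {..<Q_size i})"
proof (induction j rule: P_set.induct)
  case (3 j)
  have "{1..Suc (Suc j)} = {1..Suc j} \<union> {Suc (Suc j)}" by auto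
  then show ?case
    unfolding P_set.simps 3 Q_set_def by blast
qed (auto simp: Q_set_def)

lemma finite_P_set [simp]: "finite (P_set j)"
  by (simp add: P_set_eq)

lemma Q_size_ge_3: "1 \<le> i \<Longrightarrow> 3 \<le> Q_size i"
  by (auto simp: Q_size_def)

definition P_le :: "nat \<Rightarrow> (nat \<times> nat) rel" where
  "P_le j = {((i, p), (i', p')) | i p i' p'.
     1 \<le> i \<and> i' \<le> j \<and> p < Q_size i \<and> p' < Q_size i' \<and>
     (i = i' \<and> p \<le> p' \<or> i < i' \<and> p \<le> Q_size i - 2 \<and> Q_size i' - 2 \<le> p')}"

lemma mem_P_le:
  "((i, p), (i', p')) \<in> P_le j \<longleftrightarrow>
     1 \<le> i \<and> i' \<le> j \<and> p < Q_size i \<and> p' < Q_size i' \<and>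
     (i = i' \<and> p \<le> p' \<or> i < i' \<and> p \<le> Q_size i - 2 \<and> Q_size i' - 2 \<le> p')"
  by (simp add: P_le_def)

lemma trans_P_le: "trans (P_le j)"
  by (rule transI) (auto simp: P_le_def)

lemma P_rel_eq: "1 \<le> j \<Longrightarrow> P_rel j = P_le j"
proof (induction j rule: P_rel.induct)
  case 2
  show ?case by (auto simp: Q_rel_def P_le_def)
next
  case (3 j)
  let ?n = "Suc (Suc j)"
  let ?R = "P_rel (Suc j) \<union> Q_rel ?n \<union> {(s_elem (Suc j), s_elem ?n)}"
  have IH: "P_rel (Suc j) = P_le (Suc j)" using 3 by simp
  have s: "2 \<le> Q_size (Suc j)" "2 \<le> Q_size ?n"
    by (auto simp: Q_size_def)
  have "?R \<subseteq> P_le ?n"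
    unfolding IH using s by (auto simp: Q_rel_def s_elem_def P_le_def)
  then have "?R\<^sup>+ \<subseteq> P_le ?n"
    by (metis trancl_id trancl_mono_subset trans_P_le)
  moreover have "((i, p), (i', p')) \<in> ?R\<^sup>+" if le: "((i, p), (i', p')) \<in> P_le ?n" for i p i' p'
  proof -
    consider "i' \<le> Suc j" | "i = ?n" "i' = ?n" | "i \<le> Suc j" "i' = ?n"
      using le by (fastforce simp: mem_P_le)
    then show ?thesis
    proof cases
      case 1
      then have "((i, p), (i', p')) \<in> ?R" using le by (auto simp: IH mem_P_le)
      then show ?thesis by (rule r_into_trancl)
    next
      case 2
      then have "((i, p), (i', p')) \<in> ?R" using le by (auto simp: Q_rel_def mem_P_le)
      then show ?thesis by (rule r_into_trancl)
    next
      case 3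
      \<comment> \<open>A relation from an old element into the new chain factors through the added
        cover relation.\<close>
      have "((i, p), s_elem (Suc j)) \<in> ?R"
        using 3 le s by (auto simp: IH mem_P_le s_elem_def)
      moreover have "(s_elem (Suc j), s_elem ?n) \<in> ?R" by simp
      moreover have "(s_elem ?n, (i', p')) \<in> ?R"
        using 3 le by (auto simp: Q_rel_def s_elem_def mem_P_le)
      ultimately show ?thesis by (meson trancl.simps)
    qed
  qed
  ultimately show ?case by (auto simp: subset_iff)
qed simp

lemma partial_order_on_P_le: "partial_order_on (P_set j) (P_le j)"
  unfolding partial_order_on_def preorder_on_def
proof (intro conjI trans_P_le)
  show "P_le j \<subseteq> P_set j \<times> P_set j"
    by (auto simp: P_le_def P_set_eq)
  show "refl_on (P_set j) (P_le j)"
    by (auto simp: refl_on_def P_le_def P_set_eq)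
  show "antisym (P_le j)"
    by (rule antisymI) (auto simp: P_le_def)
qed

section \<open>A union of \<open>k\<close> antichains and its levels\<close>

text \<open>For \<open>2 \<le> i\<close> and \<open>k \<le> i\<close>, the cutoff
  \<open>i - k\<close> leaves the positions from \<open>i - k\<close> to \<open>i - 2\<close> of
  \<open>T\<^sub>i\<close>, which are \<open>k - 1\<close> in number.\<close>

definition max_family :: "nat \<Rightarrow> nat \<Rightarrow> (nat \<times> nat) set" where
  "max_family j k = {(i, p) \<in> P_set j.
     (i, p) \<noteq> (1, 0) \<and> (i < k \<or> i - k \<le> p \<and> p \<noteq> Q_size i - 2)}"

text \<open>
  For \<open>i < k\<close> the subtraction \<open>i - k\<close> truncates to \<open>0\<close>, so that all of \<open>T\<^sub>i\<close> is used, on the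
  levels \<open>0, \<dots>, i - 2\<close> just below \<open>s\<^sub>i\<close>.
\<close>

definition level :: "nat \<Rightarrow> nat \<times> nat \<Rightarrow> nat" where
  "level k = (\<lambda>(i, p).
     if p = Q_size i - 1 then k - 1 else if p = Q_size i - 2 then i - 1 else p - (i - k))"

definition r_elem :: "nat \<Rightarrow> nat \<times> nat" where
  "r_elem i = (i, Q_size i - 1)"

text \<open>Case \<open>t\<close> starts at \<open>i = 2\<close>, since \<open>T\<^sub>1\<close>
  consists of the excluded bottom \<open>(1, 0)\<close> alone.\<close>

lemma max_family_cases:
  assumes "x \<in> max_family j k"
  obtains (r) i where "x = r_elem i" "1 \<le> i" "i \<le> j"
  | (s) i where "x = s_elem i" "1 \<le> i" "i \<le> j" "i < k"
  | (t) i p where "x = (i, p)" "2 \<le> i" "i \<le> j" "p < i - 1" "i - k \<le> p"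
proof -
  obtain i p where x: "x = (i, p)" by (cases x)
  have i: "1 \<le> i" "i \<le> j" and p: "p < Q_size i" "(i, p) \<noteq> (1, 0)"
    and ip: "i < k \<or> i - k \<le> p \<and> p \<noteq> Q_size i - 2"
    using assms by (auto simp: x max_family_def P_set_eq)
  consider "p = Q_size i - 1" | "p = Q_size i - 2" | "p < Q_size i - 2"
    using p by linarith
  then show ?thesis
  proof cases
    case 1
    then show ?thesis using r i x by (simp add: r_elem_def)
  next
    case 2
    then show ?thesis using s i ip x by (simp add: s_elem_def)
  next
    case 3
    then have "i \<noteq> 1" using p by (auto simp: Q_size_def)
    moreover from this have "Q_size i = i + 1" by (simp add: Q_size_def)
    moreover have "i - k \<le> p" using ip by auto
    ultimately show ?thesis using t[of i p] i 3 x by simp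
  qed
qed

lemma level_r_elem: "level k (r_elem i) = k - 1"
  by (simp add: level_def r_elem_def)

lemma level_s_elem: "1 \<le> i \<Longrightarrow> level k (s_elem i) = i - 1"
  by (auto simp: level_def s_elem_def Q_size_def)

lemma level_T: "2 \<le> i \<Longrightarrow> p < i - 1 \<Longrightarrow> level k (i, p) = p - (i - k)"
  by (simp add: level_def Q_size_def)

lemmas level_simps = level_r_elem level_s_elem level_T

lemma level_less:
  assumes "1 \<le> k" "x \<in> max_family j k"
  shows "level k x < k"
  using assms(2) by (cases rule: max_family_cases) (use assms(1) in \<open>auto simp: level_simps\<close>)

lemma r_elem_maximal:
  assumes "(r_elem i, y) \<in> P_le j"
  shows "y = r_elem i"
proof (cases y)
  case (Pair i' p)
  then show ?thesis
    using assms Q_size_ge_3[of i] by (auto simp: r_elem_def mem_P_le)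
qed

lemma fst_mono_P_le: "(x, y) \<in> P_le j \<Longrightarrow> fst x \<le> fst y"
  by (auto simp: P_le_def)

lemma s_elem_le_iff:
  "(s_elem i, (i', p)) \<in> P_le j \<longleftrightarrow>
    1 \<le> i \<and> i \<le> i' \<and> i' \<le> j \<and> ((i', p) = s_elem i' \<or> (i', p) = r_elem i')"
  using Q_size_ge_3[of i] Q_size_ge_3[of i'] by (auto simp: r_elem_def s_elem_def mem_P_le)

lemma T_le_iff:
  "2 \<le> i \<Longrightarrow> p < i - 1 \<Longrightarrow> ((i, p), (i', p')) \<in> P_le j \<longleftrightarrow>
    i \<le> i' \<and> i' \<le> j \<and>
    ((i', p') = s_elem i' \<or> (i', p') = r_elem i' \<or> i = i' \<and> p \<le> p' \<and> p' < i - 1)"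
  using Q_size_ge_3[of i'] by (auto simp: r_elem_def s_elem_def mem_P_le Q_size_def)

text \<open>This makes the level sets antichains. Members of \<open>T\<^sub>i\<close> have level at
  most \<open>i - 2\<close>, and at most \<open>k - 2\<close> if \<open>k \<le> i\<close>; an
  \<open>s_elem i\<close> in the family has level \<open>i - 1 < k - 1\<close>; tops are maximal and
  have level \<open>k - 1\<close>.\<close>

lemma level_strict_mono:
  assumes "1 \<le> k" "x \<in> max_family j k" "y \<in> max_family j k" "(x, y) \<in> P_le j" "x \<noteq> y"
  shows "level k x < level k y"
proof -
  obtain i' p' where y: "y = (i', p')" by (cases y)
  show ?thesis
    using assms(2)
  proof (cases rule: max_family_cases)
    case (r i)
    then show ?thesis using assms(4,5) r_elem_maximal by blast
  next
    case (s i)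
    have "y = s_elem i' \<and> i < i' \<or> y = r_elem i'"
      using assms(4,5) s by (auto simp: y s_elem_le_iff le_less)
    then show ?thesis
      using s by (auto simp: level_simps)
  next
    case (t i p)
    have "i \<le> i'" "y = s_elem i' \<or> y = r_elem i' \<or> i = i' \<and> p < p' \<and> p' < i - 1"
      using assms(4,5) t by (auto simp: y T_le_iff)
    then consider "y = s_elem i'" | "y = r_elem i'" | "i = i'" "p < p'" "p' < i - 1"
      by blast
    then show ?thesis
      by cases (use t \<open>i \<le> i'\<close> in \<open>auto simp: y level_simps\<close>)
  qed
qed

definition max_antichain :: "nat \<Rightarrow> nat \<Rightarrow> nat \<Rightarrow> (nat \<times> nat) set" where
  "max_antichain j k a = {x \<in> max_family j k. level k x = a}"

lemma max_antichain_antichain: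
  "1 \<le> k \<Longrightarrow> max_antichain j k a \<in> antichains_on (P_set j) (P_le j)"
  using level_strict_mono[of k _ j]
  by (fastforce simp: antichains_on_def max_antichain_def max_family_def)

lemma Union_max_antichain: "1 \<le> k \<Longrightarrow> (\<Union>a<k. max_antichain j k a) = max_family j k"
  using level_less by (auto simp: max_antichain_def)

section \<open>Optimality of the family, giving the value of \<open>d_card\<close>\<close>

lemma card_P_set_split:
  assumes "1 \<le> k" "k \<le> Suc j" "G \<subseteq> P_set j"
  shows "card G = card (G \<inter> P_set (k - 1)) + (\<Sum>i=k..j. card (G \<inter> Q_set i))"
proof -
  have fin: "finite G" using assms(3) finite_P_set finite_subset by blast
  have "P_set j = P_set (k - 1) \<union> (\<Union>i\<in>{k..j}. Q_set i)"
    using assms(1,2) by (auto simp: P_set_eq Q_set_def)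
  then have "G = (G \<inter> P_set (k - 1)) \<union> (\<Union>i\<in>{k..j}. G \<inter> Q_set i)"
    using assms(3) by blast
  moreover have "card ((G \<inter> P_set (k - 1)) \<union> (\<Union>i\<in>{k..j}. G \<inter> Q_set i)) =
      card (G \<inter> P_set (k - 1)) + card (\<Union>i\<in>{k..j}. G \<inter> Q_set i)"
    by (rule card_Un_disjoint) (use fin assms(1) in \<open>auto simp: P_set_eq Q_set_def\<close>)
  moreover have "card (\<Union>i\<in>{k..j}. G \<inter> Q_set i) = (\<Sum>i=k..j. card (G \<inter> Q_set i))"
    by (rule card_UN_disjoint) (use fin in \<open>auto simp: Q_set_def\<close>)
  ultimately show ?thesis by simp
qed

lemma max_family_Int_Q_set_card:
  assumes "1 \<le> k" "k \<le> i" "i \<le> j"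
  shows "card (max_family j k \<inter> Q_set i) = k"
proof (cases "i = 1")
  case True
  \<comment> \<open>Here \<open>k = 1\<close>, and the exceptional three-element chain contributes
    only its top.\<close>
  then have "max_family j k \<inter> Q_set i = {(1, 2)}"
    using assms by (auto simp: max_family_def P_set_eq Q_set_def Q_size_def)
  then show ?thesis using assms True by simp
next
  case False
  then have "max_family j k \<inter> Q_set i = {i} \<times> ({i - k..i} - {i - 1})"
    using assms by (auto simp: max_family_def P_set_eq Q_set_def Q_size_def)
  then show ?thesis
    using assms False by (simp add: card_cartesian_product)
qed

lemma Q_set_chain: "1 \<le> i \<Longrightarrow> i \<le> j \<Longrightarrow> Q_set i \<in> chains_on (P_set j) (P_le j)"
  by (auto simp: chains_on_def Chains_def Q_set_def P_set_eq mem_P_le)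

text \<open>The chain of \<open>(1, 0)\<close>, then \<open>s_elem 1\<close> up to
  \<open>s_elem m\<close>, then \<open>r_elem m\<close> has \<open>m + 2\<close> elements, one more
  than \<open>m + 1\<close> antichains can cover.\<close>

lemma P_set_not_subset_Union_antichains:
  assumes "1 \<le> m" "m \<le> j" "\<forall>i<Suc m. G i \<in> antichains_on (P_set j) (P_le j)"
  shows "\<not> P_set m \<subseteq> (\<Union>i<Suc m. G i)"
proof
  define X where "X = {(1, 0), r_elem m} \<union> s_elem ` {1..m}"
  assume "P_set m \<subseteq> (\<Union>i<Suc m. G i)"
  moreover have "X \<subseteq> P_set m"
    using assms(1) by (auto simp: X_def P_set_eq s_elem_def r_elem_def Q_size_def)
  ultimately have "X \<inter> (\<Union>i<Suc m. G i) = X" by blast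
  moreover have "X \<in> chains_on (P_set j) (P_le j)"
    using assms(1,2)
    by (auto simp: X_def chains_on_def Chains_def P_set_eq s_elem_def r_elem_def mem_P_le
        Q_size_def)
  ultimately have "card X \<le> Suc m"
    using chain_Int_Union_antichains_card_le[of X _ _ "Suc m" G] assms(3) by metis
  moreover have "card X = Suc (Suc m)"
  proof -
    have "card (s_elem ` {1..m}) = m"
      by (subst card_image) (auto simp: s_elem_def inj_on_def)
    moreover have "r_elem m \<notin> s_elem ` {1..m}" "(1, 0) \<notin> s_elem ` {1..m}" "(1, 0) \<noteq> r_elem m"
      using assms(1) by (auto simp: s_elem_def r_elem_def Q_size_def)
    ultimately show ?thesis by (simp add: X_def)
  qed
  ultimately show False by simp
qed

text \<open>Any union of \<open>k\<close> antichains misses a point of \<open>P_set (k - 1)\<close>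
  if \<open>k > 1\<close>, and the family misses only one there. Each later chain
  \<open>Q_set i\<close> gives at most \<open>k\<close> points, a bound that the family
  attains.\<close>

lemma d_card_P:
  assumes "1 \<le> k" "k \<le> Suc j"
  shows "d_card (P_set j) (P_le j) k = card (max_family j k)"
  unfolding Union_max_antichain[OF assms(1), symmetric]
proof (rule d_card_eqI)
  show "finite (P_set j)" by simp
  show "\<forall>a<k. max_antichain j k a \<in> antichains_on (P_set j) (P_le j)"
    using max_antichain_antichain assms(1) by blast
next
  fix G assume G: "\<forall>i<k. G i \<in> antichains_on (P_set j) (P_le j)"
  let ?U = "\<Union>i<k. G i"
  have U: "?U \<subseteq> P_set j" using G by (auto simp: antichains_on_def)
  have F: "max_family j k \<subseteq> P_set j" by (auto simp: max_family_def)
  have "card (?U \<inter> P_set (k - 1)) \<le> card (max_family j k \<inter> P_set (k - 1))"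
  \<comment> \<open>For \<open>k = 1\<close> both sides vanish, as the dummy value
    \<open>P_set 0\<close> is empty.\<close>
  proof (cases "k = 1")
    case False
    then obtain m where k: "k = Suc m" "1 \<le> m" using assms(1) by (cases k) auto
    have "max_family j k \<inter> P_set m = P_set m - {(1, 0)}"
      using k assms(2) by (auto simp: max_family_def P_set_eq)
    moreover have "(1, 0) \<in> P_set m"
      using k by (auto simp: P_set_eq Q_size_def)
    moreover have "?U \<inter> P_set m \<subset> P_set m"
      using P_set_not_subset_Union_antichains[of m j G] k assms(2) G by auto
    then have "card (?U \<inter> P_set m) < card (P_set m)"
      by (intro psubset_card_mono) simp_all
    ultimately show ?thesis using k by simp
  qed simp
  moreover have "(\<Sum>i=k..j. card (?U \<inter> Q_set i)) \<le> (\<Sum>i=k..j. card (max_family j k \<inter> Q_set i))"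
  proof (rule sum_mono)
    fix i assume i: "i \<in> {k..j}"
    have "card (Q_set i \<inter> ?U) \<le> k"
      by (rule chain_Int_Union_antichains_card_le[OF Q_set_chain G]) (use i assms(1) in auto)
    moreover have "card (max_family j k \<inter> Q_set i) = k"
      using i assms(1) by (intro max_family_Int_Q_set_card) auto
    ultimately show "card (?U \<inter> Q_set i) \<le> card (max_family j k \<inter> Q_set i)"
      by (simp only: Int_commute)
  qed
  ultimately show "card ?U \<le> card (\<Union>a<k. max_antichain j k a)"
    unfolding Union_max_antichain[OF assms(1)]
    using card_P_set_split[OF assms U] card_P_set_split[OF assms F] by linarith
qed

section \<open>The height bound and the shape of chains in saturated partitions\<close>

lemma saturated_chain_Int_max_family_card:
  assumes "1 \<le> k" "k \<le> Suc j" "chain_partition (P_set j) (P_le j) \<C>"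
    and "saturated (P_set j) (P_le j) k \<C>" "X \<in> \<C>" "x \<in> X" "x \<notin> max_family j k"
  shows "card (X \<inter> max_family j k) = k"
  using saturated_chain_Int_card_eq[OF _ assms(3,4), of "max_antichain j k" X x]
    max_antichain_antichain[OF assms(1)] Union_max_antichain[OF assms(1)] d_card_P assms
  by simp

text \<open>For \<open>k = Suc j\<close> the family contains everything except
  \<open>(1, 0)\<close>, so a chain has at most \<open>j + 1\<close> elements besides that
  point.\<close>

lemma height_P_le:
  assumes "1 \<le> j"
  shows "height (P_set j) (P_le j) \<le> j + 2"
proof -
  let ?H = "chains_on (P_set j) (P_le j)"
  have "finite ?H"
    by (rule finite_subset[of _ "Pow (P_set j)"]) (auto simp: chains_on_def)
  moreover have "{} \<in> ?H"
    by (auto simp: chains_on_def Chains_def)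
  moreover have "card X \<le> j + 2" if X: "X \<in> ?H" for X
  proof -
    have "X \<subseteq> insert (1, 0) (X \<inter> max_family j (Suc j))"
      using X by (auto simp: chains_on_def max_family_def P_set_eq)
    then have "card X \<le> card (insert (1, 0) (X \<inter> max_family j (Suc j)))"
      by (rule card_mono[rotated]) (auto simp: max_family_def intro!: finite_subset[OF _ finite_P_set])
    also have "\<dots> \<le> Suc (card (X \<inter> max_family j (Suc j)))"
      by (rule card_insert_le_m1) simp_all
    also have "card (X \<inter> max_family j (Suc j)) \<le> Suc j"
      using chain_Int_Union_antichains_card_le[OF X, of "Suc j" "max_antichain j (Suc j)"]
        max_antichain_antichain Union_max_antichain[of "Suc j" j]
      by simp
    finally show ?thesis by simp
  qed
  ultimately show ?thesis
    unfolding height_def by (subst Max_le_iff) auto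
qed

lemma chain_comparable:
  "X \<in> chains_on A r \<Longrightarrow> x \<in> X \<Longrightarrow> y \<in> X \<Longrightarrow> (x, y) \<in> r \<or> (y, x) \<in> r"
  by (auto simp: chains_on_def Chains_def)

text \<open>The family contains only \<open>l - 1\<close> of the \<open>s\<close> elements, and
  \<open>X\<close> holds at most one top. Meeting the family in \<open>l\<close> points therefore
  requires all of these \<open>s\<close> elements and a top above
  \<open>s_elem (l - 1)\<close>.\<close>

lemma chain_through_u:
  assumes "3 \<le> l" "l \<le> Suc j" "chain_partition (P_set j) (P_le j) \<C>"
    and "saturated (P_set j) (P_le j) l \<C>" "X \<in> \<C>" "(1, 0) \<in> X"
  obtains b where "l - 1 \<le> b" "b \<le> j" "r_elem b \<in> X"
proof -
  let ?S = "s_elem ` {1..<l}" and ?R = "r_elem ` {1..j}"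
  have X: "X \<in> chains_on (P_set j) (P_le j)"
    using assms(3,5) by (auto simp: chain_partition_def)
  have "card (X \<inter> max_family j l) = l"
    by (rule saturated_chain_Int_max_family_card[OF _ _ assms(3-6)])
      (use assms(1,2) in \<open>simp_all add: max_family_def\<close>)
  moreover have "X \<inter> max_family j l \<subseteq> (X \<inter> ?S) \<union> (X \<inter> ?R)"
  proof
    fix x assume x: "x \<in> X \<inter> max_family j l"
    then have "x \<in> X" "x \<in> max_family j l" by auto
    from this(2) show "x \<in> (X \<inter> ?S) \<union> (X \<inter> ?R)"
    proof (cases rule: max_family_cases)
      \<comment> \<open>For \<open>i \<ge> 2\<close>, no member of \<open>T\<^sub>i\<close> is
        comparable with \<open>(1, 0)\<close>.\<close>
      case (t i p)
      then show ?thesis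
        using chain_comparable[OF X assms(6) \<open>x \<in> X\<close>] by (auto simp: mem_P_le Q_size_def)
    qed (use \<open>x \<in> X\<close> in auto)
  qed
  then have "card (X \<inter> max_family j l) \<le> card ((X \<inter> ?S) \<union> (X \<inter> ?R))"
    by (intro card_mono) auto
  moreover have "card ((X \<inter> ?S) \<union> (X \<inter> ?R)) \<le> card (X \<inter> ?S) + card (X \<inter> ?R)"
    by (rule card_Un_le)
  moreover have R: "card (X \<inter> ?R) \<le> 1"
    by (rule chain_Int_antichain_card_le_1[OF X])
      (use r_elem_maximal in \<open>fastforce simp: antichains_on_def r_elem_def P_set_eq Q_size_def\<close>)
  moreover have S: "card ?S = l - 1"
    by (subst card_image) (auto simp: s_elem_def inj_on_def)
  moreover have "card (X \<inter> ?S) \<le> card ?S"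
    by (rule card_mono) auto
  ultimately have "card (X \<inter> ?R) \<noteq> 0" "card (X \<inter> ?S) = card ?S"
    using assms(1) by linarith+
  then have "X \<inter> ?R \<noteq> {}"
    by (metis card.empty)
  then obtain b where b: "b \<in> {1..j}" "r_elem b \<in> X" by blast
  have "X \<inter> ?S = ?S"
    by (rule card_subset_eq) (use \<open>card (X \<inter> ?S) = card ?S\<close> in simp_all)
  moreover have "s_elem (l - 1) \<in> ?S"
    using assms(1) by (intro imageI) simp
  ultimately have "s_elem (l - 1) \<in> X" by blast
  moreover have "s_elem (l - 1) \<noteq> r_elem b"
    using b(1) by (auto simp: s_elem_def r_elem_def Q_size_def)
  ultimately have "(s_elem (l - 1), r_elem b) \<in> P_le j"
    using chain_comparable[OF X _ b(2)] r_elem_maximal by blast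
  then have "l - 1 \<le> b"
    using fst_mono_P_le by (fastforce simp: s_elem_def r_elem_def)
  then show ?thesis using b that by auto
qed

text \<open>Since \<open>k < i\<close>, the bottom \<open>(i, 0)\<close> is outside the family, so
  \<open>X\<close> must contain \<open>k\<close> of its members. Without a top from
  \<open>Q\<^sub>i\<close> or later, only \<open>k - 1\<close> members in \<open>T\<^sub>i\<close>
  are available: any \<open>s_elem m\<close> comparable with \<open>(i, 0)\<close> has
  \<open>m \<ge> i > k\<close> and is not in the family.\<close>

lemma chain_through_bottom:
  assumes "1 \<le> k" "k < i" "i \<le> j" "chain_partition (P_set j) (P_le j) \<C>"
    and "saturated (P_set j) (P_le j) k \<C>" "X \<in> \<C>" "(i, 0) \<in> X"
  obtains a where "i \<le> a" "a \<le> j" "r_elem a \<in> X"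
proof -
  let ?T = "{i} \<times> {i - k..<i - 1}" and ?R = "r_elem ` {i..j}"
  have X: "X \<in> chains_on (P_set j) (P_le j)"
    using assms(4,6) by (auto simp: chain_partition_def)
  have "card (X \<inter> max_family j k) = k"
    by (rule saturated_chain_Int_max_family_card[OF _ _ assms(4-7)])
      (use assms(1-3) in \<open>simp_all add: max_family_def\<close>)
  moreover have "X \<inter> max_family j k \<subseteq> ?T" if "X \<inter> ?R = {}"
  proof
    fix x assume "x \<in> X \<inter> max_family j k"
    then have "x \<in> X" "x \<in> max_family j k" by auto
    note comp = chain_comparable[OF X assms(7) \<open>x \<in> X\<close>]
    from \<open>x \<in> max_family j k\<close> show "x \<in> ?T"
    proof (cases rule: max_family_cases)
      case (r m)
      then have "m < i" using that \<open>x \<in> X\<close> by fastforce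
      then show ?thesis
        using comp r Q_size_ge_3[of m] by (auto simp: r_elem_def mem_P_le)
    next
      case (s m)
      then show ?thesis
        using comp assms(1,2) by (auto simp: s_elem_def mem_P_le Q_size_def split: if_splits)
    next
      case (t m p)
      then show ?thesis
        using comp assms(1,2) by (auto simp: mem_P_le Q_size_def split: if_splits)
    qed
  qed
  then have "card (X \<inter> max_family j k) \<le> card ?T" if "X \<inter> ?R = {}"
    using that by (intro card_mono) auto
  moreover have "card ?T < k"
    using assms(1,2) by (simp add: card_cartesian_product)
  ultimately have "X \<inter> ?R \<noteq> {}" by fastforce
  then show ?thesis using that by auto
qed

section \<open>Counting tops against bottoms, and the conclusion\<close>

lemma not_saturated_twice:
  assumes "1 \<le> k" "k + 2 \<le> l" "l \<le> Suc j" "chain_partition (P_set j) (P_le j) \<C>"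
    and "saturated (P_set j) (P_le j) k \<C>" "saturated (P_set j) (P_le j) l \<C>"
  shows False
proof -
  have part: "partition_on (P_set j) \<C>" and chains: "\<C> \<subseteq> chains_on (P_set j) (P_le j)"
    using assms(4) by (auto simp: chain_partition_def)
  have ex: "\<exists>X\<in>\<C>. (i, 0) \<in> X" if "1 \<le> i" "i \<le> j" for i
  proof -
    have "(i, 0) \<in> P_set j"
      using that by (auto simp: P_set_eq Q_size_def)
    then show ?thesis using partition_onD1[OF part] by auto
  qed
  \<comment> \<open>Bottoms of different \<open>Q\<^sub>i\<close> are incomparable, so their blocks
    are disjoint and cannot share a top.\<close>
  have same_bottom: "i = i'"
    if "X \<in> \<C>" "Y \<in> \<C>" "(i, 0) \<in> X" "(i', 0) \<in> Y" "z \<in> X" "z \<in> Y" for i i' X Y z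
  proof -
    have "X = Y"
      using partition_onD2[OF part] that by (auto simp: disjoint_def)
    then have "((i, 0), (i', 0)) \<in> P_le j \<or> ((i', 0), (i, 0)) \<in> P_le j"
      using that chains by (intro chain_comparable) auto
    then show ?thesis
      by (auto simp: mem_P_le Q_size_def split: if_splits)
  qed
  obtain X where X: "X \<in> \<C>" "(1, 0) \<in> X"
    using ex[of 1] assms by auto
  obtain b where b: "l - 1 \<le> b" "b \<le> j" "r_elem b \<in> X"
    using chain_through_u[OF _ assms(3,4,6) X] assms(1,2) by auto
  have "\<exists>a Y. Y \<in> \<C> \<and> (i, 0) \<in> Y \<and> i \<le> a \<and> a \<le> j \<and> r_elem a \<in> Y" if "i \<in> {k<..j}" for i
  proof -
    have "1 \<le> i" "i \<le> j" using that by auto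
    then obtain Y where Y: "Y \<in> \<C>" "(i, 0) \<in> Y" using ex by blast
    then show ?thesis
      using chain_through_bottom[OF assms(1) _ _ assms(4,5) Y] that
      by (metis greaterThanAtMost_iff)
  qed
  then obtain a Y where Y: "\<And>i. i \<in> {k<..j} \<Longrightarrow>
      Y i \<in> \<C> \<and> (i, 0) \<in> Y i \<and> i \<le> a i \<and> a i \<le> j \<and> r_elem (a i) \<in> Y i"
    by metis
  have "inj_on a {k<..j}"
    by (rule inj_onI) (metis Y same_bottom)
  moreover have "a i \<noteq> b" if "i \<in> {k<..j}" for i
  proof
    assume "a i = b"
    then have "1 = i"
      using same_bottom[of X "Y i" 1 i "r_elem b"] X b(3) Y[OF that] by blast
    then show False using that assms(1) by simp
  qed
  then have "a ` {k<..j} \<subseteq> {k<..j} - {b}"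
    using Y by fastforce
  then have "card (a ` {k<..j}) \<le> card ({k<..j} - {b})"
    by (intro card_mono) auto
  \<comment> \<open>The gap \<open>k + 2 \<le> l\<close> enters here: it gives
    \<open>b \<ge> l - 1 > k\<close>, so \<open>b\<close> takes one of the indices needed by the
    injective map \<open>a\<close>.\<close>
  moreover have "b \<in> {k<..j}" using b assms(2) by auto
  then have "card ({k<..j} - {b}) < card {k<..j}"
    by (intro card_Diff1_less) auto
  ultimately show False by (simp add: card_image)
qed

theorem lemma2p3:
  fixes j :: nat
  assumes "1 \<le> j"
  shows "polyunsaturated (P_set j) (P_rel j)"
proof -
  let ?sat = "saturated (P_set j) (P_le j)" and ?h = "height (P_set j) (P_le j)"
  have "False"
    if kl: "0 < k" "k < ?h" "0 < l" "l < ?h" "k \<noteq> l" "k \<noteq> Suc l" "l \<noteq> Suc k"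
      and C: "chain_partition (P_set j) (P_le j) \<C>" "?sat k \<C>" "?sat l \<C>" for k l \<C>
  proof -
    \<comment> \<open>By the height bound, the larger index is at most \<open>Suc j\<close> in
      either case.\<close>
    consider "k + 2 \<le> l" | "l + 2 \<le> k" using kl by linarith
    then show False
      using not_saturated_twice[OF _ _ _ C(1), of k l]
        not_saturated_twice[OF _ _ _ C(1), of l k] C kl height_P_le[OF assms]
      by cases auto
  qed
  then show ?thesis
    unfolding polyunsaturated_def P_rel_eq[OF assms]
    using partial_order_on_P_le by auto
qed

end
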